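(* Let $W \in \mathbb{R}^{|\mathcal{V}| \times d_{\text{model}}}$ be the weight matrix whose rows are $\bm{w}_v^\top$ ($v\in\mathcal{V}$), and let $\bm{b} \in \mathbb{R}^{|\mathcal{V}|}$ be the vector of biases $b_v$. The point $\hat{\bm{z}}_\star$ that minimizes the logit variance across $\mathcal{V}$, i.e. $$\hat{\bm{z}}_\star = \arg\min_{\bm{z}} \sum_{v\in\mathcal{V}}\left(\bm{w}_v^\top\bm{z}+b_v-\bar{l}\right)^2,\qquad \bar{l}=\frac{1}{|\mathcal{V}|}\sum_{v\in\mathcal{V}}\left(\bm{w}_v^\top\bm{z}+b_v\right),$$ is given by $$\hat{\bm{z}}_\star = -(W^\top P W)^\dagger W^\top P\,\bm{b},$$ where $P = I-\frac{1}{|\mathcal{V}|}\mathbf{1}\mathbf{1}^\top$, with $I$ denoting the identity matrix, $\mathbf{1}$ the all-ones vector, and $(\cdot)^\dagger$ the Moore--Penrose pseudo-inverse.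
   Context: $\mathcal{V}$ is the (finite) vocabulary of a large language model and $d_{\text{model}}$ is its model dimension. The language head is viewed as a linear classifier over $\mathcal{V}$: for a feature $\bm{z}\in\mathbb{R}^{d_{\text{model}}}$, the logit of token $v\in\mathcal{V}$ is $\bm{w}_v^\top\bm{z}+b_v$, where $\bm{w}_v\in\mathbb{R}^{d_{\text{model}}}$ and $b_v\in\mathbb{R}$ are the weight vector and bias associated with token $v$. A decision-neutral closest point of the head is defined as the feature that minimizes the variance of the logits across the entire vocabulary, i.e. the $\arg\min$ over $\bm{z}$ of the sum of squared deviations of the logits from their mean $\bar{l}$ over the vocabulary. *)

theory Defs
  imports "HOL-Analysis.Analysis"
begin

text \<open>The vocabulary is the finite index type \<open>'v\<close> and feature space is \<open>real ^ 'd\<close>; row \<open>v\<close> of the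
  weight matrix \<open>W :: real ^ 'd ^ 'v\<close> is the weight vector of token \<open>v\<close>.\<close>

definition logit :: "real ^ 'd ^ 'v \<Rightarrow> real ^ 'v \<Rightarrow> real ^ 'd \<Rightarrow> 'v \<Rightarrow> real" where
  "logit W b z v = row v W \<bullet> z + b $ v"

definition mean_logit :: "real ^ 'd ^ 'v \<Rightarrow> real ^ 'v \<Rightarrow> real ^ 'd \<Rightarrow> real" where
  "mean_logit W b z = (1 / real CARD('v)) * (\<Sum>v\<in>UNIV. logit W b z v)"

definition logit_deviation :: "real ^ 'd ^ 'v \<Rightarrow> real ^ 'v \<Rightarrow> real ^ 'd \<Rightarrow> real" where
  "logit_deviation W b z = (\<Sum>v\<in>UNIV. (logit W b z v - mean_logit W b z)\<^sup>2)"

definition neutral_closest_point :: "real ^ 'd ^ 'v \<Rightarrow> real ^ 'v \<Rightarrow> real ^ 'd \<Rightarrow> bool" where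
  "neutral_closest_point W b = is_arg_min (logit_deviation W b) (\<lambda>z. True)"

text \<open>In \<open>HOL-Analysis\<close>, \<open>1 :: real ^ 'v\<close> is the all-ones vector; the index type \<open>1\<close> makes it a
  matrix with one column, respectively one row.\<close>

definition centering_matrix :: "real ^ 'v ^ 'v" where
  "centering_matrix =
     mat 1 - (1 / real CARD('v)) *\<^sub>R ((columnvector 1 :: real ^ 1 ^ 'v) ** (rowvector 1 :: real ^ 'v ^ 1))"

text \<open>The Moore--Penrose pseudo-inverse is the unique solution of the four Penrose equations. For
  real matrices the conjugate transpose is the transpose.\<close>

definition is_pseudo_inverse :: "real ^ 'n ^ 'm \<Rightarrow> real ^ 'm ^ 'n \<Rightarrow> bool" where
  "is_pseudo_inverse A X \<longleftrightarrow>
     A ** X ** A = A \<and>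
     X ** A ** X = X \<and>
     transpose (A ** X) = A ** X \<and>
     transpose (X ** A) = X ** A"

definition pseudo_inverse :: "real ^ 'n ^ 'm \<Rightarrow> real ^ 'm ^ 'n" where
  "pseudo_inverse A = (THE X. is_pseudo_inverse A X)"

lemma is_pseudo_inverse_unique:
  assumes X: "is_pseudo_inverse A X" and Y: "is_pseudo_inverse A Y"
  shows "X = Y"
proof -
  note x = X[unfolded is_pseudo_inverse_def] and y = Y[unfolded is_pseudo_inverse_def]
  have "A ** X = transpose (A ** Y ** A ** X)"
    using x y by simp
  also have "\<dots> = transpose (A ** X) ** transpose (A ** Y)"
    by (simp add: matrix_transpose_mul matrix_mul_assoc)
  also have "\<dots> = A ** X ** A ** Y"
    using x y by (simp add: matrix_mul_assoc)
  finally have AX: "A ** X = A ** Y"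
    using x by simp
  have "X ** A = transpose (X ** (A ** Y ** A))"
    using x y by simp
  also have "\<dots> = transpose (Y ** A) ** transpose (X ** A)"
    by (simp add: matrix_transpose_mul matrix_mul_assoc)
  also have "\<dots> = Y ** A ** (X ** A)"
    using x y by simp
  also have "\<dots> = Y ** (A ** X ** A)"
    by (simp only: matrix_mul_assoc)
  finally have XA: "X ** A = Y ** A"
    using x by simp
  have "X = X ** (A ** X)"
    using x by (simp add: matrix_mul_assoc)
  also have "\<dots> = Y ** A ** Y"
    using AX XA by (simp add: matrix_mul_assoc)
  finally show ?thesis
    using y by simp
qed

lemma normal_equations_solvable:
  fixes A :: "real ^ 'n ^ 'm"
  shows "\<exists>Y. transpose A ** A ** Y = transpose A"
proof -
  have "\<exists>x. transpose A *v (A *v x) = transpose A *v y" for y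
  proof -
    obtain p q where p: "p \<in> span (range ((*v) A))"
      and q: "\<And>w. w \<in> span (range ((*v) A)) \<Longrightarrow> orthogonal q w" and y: "y = p + q"
      using orthogonal_subspace_decomp_exists[of "range ((*v) A)" y] by metis
    have "span (range ((*v) A)) = range ((*v) A)"
      by (intro span_eq_iff[THEN iffD2] linear_subspace_image) auto
    with p obtain x where x: "p = A *v x"
      by blast
    have "(transpose A *v q) \<bullet> w = 0" for w
      using q[OF span_base, of "A *v w"]
      by (simp add: orthogonal_def dot_lmul_matrix)
    then have "transpose A *v q = 0"
      using inner_eq_zero_iff by blast
    then have "transpose A *v (A *v x) = transpose A *v y"
      by (simp add: y x matrix_vector_right_distrib)
    then show ?thesis ..
  qed
  then obtain g where g: "\<And>y. transpose A *v (A *v g y) = transpose A *v y"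
    by metis
  define Y :: "real ^ 'm ^ 'n" where "Y = (\<chi> i j. g (axis j 1) $ i)"
  have "column j (transpose A ** A ** Y) = column j (transpose A)" for j
  proof -
    have "Y *v axis j 1 = g (axis j 1)"
      by (simp add: matrix_vector_mul_component vec_eq_iff Y_def matrix_vector_mult_basis column_def)
    then show ?thesis
      using g[of "axis j 1"]
      by (metis matrix_vector_mul_assoc matrix_vector_mult_basis)
  qed
  then have "transpose A ** A ** Y = transpose A"
    by (simp add: vec_eq_iff column_def)
  then show ?thesis ..
qed

lemma is_pseudo_inverse_exists:
  fixes A :: "real ^ 'n ^ 'm"
  shows "\<exists>X. is_pseudo_inverse A X"
proof -
  have *: "B ** Y ** B = B \<and> transpose (B ** Y) = B ** Y"
    if "transpose B ** B ** Y = transpose B" for B :: "real ^ 'a ^ 'b" and Y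
  proof -
    have "transpose (transpose B ** B ** Y) = B"
      by (simp add: that)
    then have 1: "transpose Y ** transpose B ** B = B"
      by (simp add: matrix_transpose_mul matrix_mul_assoc)
    then have "B ** Y = transpose Y ** (transpose B ** B ** Y)"
      by (simp add: matrix_mul_assoc)
    also have "\<dots> = transpose (B ** Y)"
      by (simp add: that matrix_transpose_mul)
    finally show ?thesis
      using 1 by (simp add: matrix_transpose_mul)
  qed
  obtain Y where "transpose A ** A ** Y = transpose A"
    using normal_equations_solvable by blast
  from *[OF this] have Y: "A ** Y ** A = A" "transpose (A ** Y) = A ** Y"
    by auto
  obtain V where "transpose (transpose A) ** transpose A ** V = transpose (transpose A)"
    using normal_equations_solvable by blast
  from *[OF this] have V: "transpose A ** V ** transpose A = transpose A"
    "transpose (transpose A ** V) = transpose A ** V"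
    by auto
  define Z where "Z = transpose V"
  have Z: "A ** Z ** A = A" "transpose (Z ** A) = Z ** A"
    using arg_cong[OF V(1), of transpose] V(2)
    by (simp_all add: Z_def matrix_transpose_mul matrix_mul_assoc)
  have 1: "A ** (Z ** A ** Y) = A ** Y" and 2: "Z ** A ** Y ** A = Z ** A"
    using Z(1) Y(1) by (simp_all add: matrix_mul_assoc) (metis matrix_mul_assoc)
  have "is_pseudo_inverse A (Z ** A ** Y)"
    unfolding is_pseudo_inverse_def 1 2
    using Y Z by (simp add: matrix_mul_assoc) (metis matrix_mul_assoc)
  then show ?thesis ..
qed

lemma is_pseudo_inverse_pseudo_inverse: "is_pseudo_inverse A (pseudo_inverse A)"
  unfolding pseudo_inverse_def
  using is_pseudo_inverse_exists is_pseudo_inverse_unique by (metis theI)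

end

theory Submission
  imports Defs
begin

text \<open>The centering matrix \<open>P\<close> is symmetric and idempotent, so the logit deviation at \<open>z\<close> is the
  least-squares residual \<open>\<parallel>A z + c\<parallel>\<^sup>2\<close> with \<open>A = P W\<close> and \<open>c = P b\<close>. Since \<open>M = A\<^sup>T A\<close> has the range of
  \<open>A\<^sup>T\<close>, the point \<open>- M\<^sup>\<dagger> A\<^sup>T c\<close> solves the normal equations, and the residual at \<open>z\<close> exceeds its value
  there by the square of the norm of \<open>A\<close> times the displacement. The minimizers therefore differ from
  it by kernel vectors of \<open>M\<close>, to which it is orthogonal because \<open>M\<^sup>\<dagger> M\<close> is a symmetric projection
  fixing it.\<close>

lemma inner_matrix_vector_mult_left:
  fixes A :: "real ^ 'n ^ 'm"
  shows "(A *v x) \<bullet> y = x \<bullet> (transpose A *v y)"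
  by (metis dot_lmul_matrix inner_commute transpose_matrix_vector)

text \<open>Solvability of the normal equations writes \<open>transpose A\<close> as
  \<open>M ** Y\<close>, and \<open>M ** pseudo_inverse M\<close> fixes everything of that form by
  the first Penrose equation.\<close>

lemma pseudo_inverse_gram:
  fixes A :: "real ^ 'n ^ 'm"
  defines "M \<equiv> transpose A ** A"
  shows "M ** pseudo_inverse M ** transpose A = transpose A"
proof -
  obtain Y where Y: "M ** Y = transpose A"
    using normal_equations_solvable[of A] by (auto simp: M_def)
  have "M ** pseudo_inverse M ** M = M"
    using is_pseudo_inverse_pseudo_inverse[of M] by (simp add: is_pseudo_inverse_def)
  then show ?thesis
    by (metis Y matrix_mul_assoc)
qed

lemma orthogonal_pseudo_inverse_kernel:
  fixes M :: "real ^ 'n ^ 'm"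
  assumes "M *v h = 0"
  shows "orthogonal (pseudo_inverse M *v y) h"
proof -
  let ?N = "pseudo_inverse M"
  have "?N ** M ** ?N = ?N" "transpose (?N ** M) = ?N ** M"
    using is_pseudo_inverse_pseudo_inverse[of M] by (simp_all add: is_pseudo_inverse_def)
  \<comment> \<open>Expand \<open>?N\<close> on the left as \<open>?N ** M ** ?N\<close>, then move
    the symmetric factor \<open>?N ** M\<close> across the inner product onto
    \<open>h\<close>.\<close>
  then have "(?N *v y) \<bullet> h = (?N *v y) \<bullet> (?N *v (M *v h))"
    by (metis inner_matrix_vector_mult_left matrix_vector_mul_assoc)
  then show ?thesis
    by (simp add: assms orthogonal_def)
qed

lemma least_squares_decomposition:
  fixes A :: "real ^ 'n ^ 'm" and c :: "real ^ 'm"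
  defines "zs \<equiv> - (pseudo_inverse (transpose A ** A) *v (transpose A *v c))"
  shows "(norm (A *v z + c))\<^sup>2 = (norm (A *v zs + c))\<^sup>2 + (norm (A *v (z - zs)))\<^sup>2"
proof -
  have "transpose A *v (A *v (pseudo_inverse (transpose A ** A) *v (transpose A *v c)))
      = transpose A *v c"
    using arg_cong[OF pseudo_inverse_gram[of A], of "\<lambda>B. B *v c"]
    by (simp add: matrix_vector_mul_assoc matrix_mul_assoc del: transpose_matrix_vector)
  then have "transpose A *v (A *v zs + c) = 0"
    by (simp add: zs_def matrix_vector_mult_diff_distrib linear_neg[OF matrix_vector_mul_linear]
        del: transpose_matrix_vector)
  then have "orthogonal (A *v zs + c) (A *v (z - zs))"
    by (simp add: orthogonal_def inner_commute inner_matrix_vector_mult_left)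
  moreover have "A *v z + c = (A *v zs + c) + A *v (z - zs)"
    by (simp add: matrix_vector_mult_diff_distrib)
  ultimately show ?thesis
    by (metis norm_add_Pythagorean)
qed

text \<open>Pairing \<open>(transpose A ** A) *v h\<close> with \<open>h\<close> gives the squared
  norm of \<open>A *v h\<close>.\<close>

lemma gram_kernel:
  fixes A :: "real ^ 'n ^ 'm"
  shows "(transpose A ** A) *v h = 0 \<longleftrightarrow> A *v h = 0"
proof
  assume "(transpose A ** A) *v h = 0"
  then have "(A *v h) \<bullet> (A *v h) = 0"
    by (simp add: inner_matrix_vector_mult_left matrix_vector_mul_assoc)
  then show "A *v h = 0"
    by simp
qed (simp flip: matrix_vector_mul_assoc)

lemma centering_matrix_nth:
  "(centering_matrix :: real ^ 'v ^ 'v) $ i $ j = (if i = j then 1 else 0) - 1 / real CARD('v)"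
  by (simp add: centering_matrix_def mat_def matrix_matrix_mult_def columnvector_def rowvector_def)

lemma centering_matrix_mult:
  fixes x :: "real ^ 'v"
  shows "(centering_matrix *v x) $ v = x $ v - (\<Sum>u\<in>UNIV. x $ u) / real CARD('v)"
  by (simp add: matrix_vector_mult_def centering_matrix_nth left_diff_distrib sum_subtractf
      if_distrib[of "\<lambda>c. c * _"] sum_divide_distrib cong: if_cong)

lemma transpose_centering_matrix: "transpose centering_matrix = centering_matrix"
  by (simp add: vec_eq_iff transpose_def centering_matrix_nth)

lemma centering_matrix_idempotent:
  "centering_matrix ** centering_matrix = (centering_matrix :: real ^ 'v ^ 'v)"
proof -
  \<comment> \<open>A centered vector has mean zero, so centering it again subtracts
    nothing.\<close>
  have "(\<Sum>v\<in>UNIV. (centering_matrix *v x) $ v) = 0" for x :: "real ^ 'v"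
    by (simp add: centering_matrix_mult sum_subtractf)
  then have "centering_matrix *v (centering_matrix *v x) = centering_matrix *v x" for x :: "real ^ 'v"
    by (simp add: vec_eq_iff centering_matrix_mult[of "centering_matrix *v x"])
  then show ?thesis
    by (simp add: matrix_eq matrix_vector_mul_assoc)
qed

lemma logit_deviation_eq_norm:
  "logit_deviation W b z = (norm (centering_matrix ** W *v z + centering_matrix *v b))\<^sup>2"
proof -
  have "logit W b z v = (W *v z + b) $ v" for v
    by (simp add: logit_def matrix_vector_mul_component row_def)
  then have "logit W b z v - mean_logit W b z = (centering_matrix *v (W *v z + b)) $ v" for v
    by (simp add: mean_logit_def centering_matrix_mult)
  then have "logit_deviation W b z = (norm (centering_matrix *v (W *v z + b)))\<^sup>2"
    by (simp add: logit_deviation_def norm_vec_def L2_set_def sum_nonneg)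
  then show ?thesis
    by (simp add: matrix_vector_right_distrib matrix_vector_mul_assoc)
qed

text \<open>When the Gram matrix is singular the arg min may be a whole affine subspace. The formula
  is then identified as its unique element of least norm.\<close>

theorem lemma4p1:
  fixes W :: "real ^ 'd ^ 'v" and b :: "real ^ 'v"
    and P :: "real ^ 'v ^ 'v" and z_star :: "real ^ 'd"
  assumes P: "P = centering_matrix"
    and z_star: "z_star = - (pseudo_inverse (transpose W ** P ** W) ** transpose W ** P *v b)"
  shows "neutral_closest_point W b z_star \<and>
    (invertible (transpose W ** P ** W) \<longrightarrow> (\<forall>z. neutral_closest_point W b z \<longrightarrow> z = z_star)) \<and>
    (\<forall>z. neutral_closest_point W b z \<and> z \<noteq> z_star \<longrightarrow> norm z_star < norm z)"
proof -
  define A where "A = P ** W"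
  let ?M = "transpose W ** P ** W"
  have PP: "P ** P = P" and At: "transpose A = transpose W ** P"
    by (simp_all add: P A_def matrix_transpose_mul centering_matrix_idempotent
        transpose_centering_matrix)
  have "transpose A ** A = transpose W ** (P ** P) ** W"
    by (simp add: At) (simp add: A_def matrix_mul_assoc)
  then have M: "transpose A ** A = ?M"
    by (simp add: PP)
  have "transpose A ** P = transpose W ** (P ** P)"
    by (simp add: At matrix_mul_assoc)
  then have "transpose A *v (P *v b) = transpose W ** P *v b"
    by (simp add: PP matrix_vector_mul_assoc)
  then have zs: "z_star = - (pseudo_inverse ?M *v (transpose A *v (P *v b)))"
    by (simp add: z_star matrix_vector_mul_assoc matrix_mul_assoc)
  have dev: "logit_deviation W b z = logit_deviation W b z_star + (norm (A *v (z - z_star)))\<^sup>2" for z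
    using least_squares_decomposition[of A z "P *v b"]
    unfolding M logit_deviation_eq_norm zs[symmetric] P[symmetric] A_def[symmetric] .
  have ncp: "neutral_closest_point W b z_star"
    unfolding neutral_closest_point_def is_arg_min_linorder
    \<comment> \<open>Only the deviation at the competing point is expanded; \<open>dev\<close>
      would match the one at \<open>z_star\<close> too.\<close>
    by (subst (2) dev) simp
  have ker: "?M *v (z - z_star) = 0" if "neutral_closest_point W b z" for z
  proof -
    have "logit_deviation W b z \<le> logit_deviation W b z_star"
      using that by (simp add: neutral_closest_point_def is_arg_min_linorder)
    then have "A *v (z - z_star) = 0"
      using dev[of z] by simp
    then show ?thesis
      using gram_kernel[of A] by (simp add: M)
  qed
  have "z = z_star" if "invertible ?M" "neutral_closest_point W b z" for z
    using ker[OF that(2)] that(1)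
    by (metis invertible_def matrix_vector_mul_assoc matrix_vector_mul_lid
        matrix_vector_mult_0_right right_minus_eq)
  moreover have "norm z_star < norm z" if "neutral_closest_point W b z" "z \<noteq> z_star" for z
  proof -
    \<comment> \<open>\<open>z_star\<close> is minus a value of the pseudo-inverse, while
      \<open>ker\<close> puts the displacement in the kernel of \<open>?M\<close>.\<close>
    have "orthogonal z_star (z - z_star)"
      using orthogonal_pseudo_inverse_kernel[OF ker[OF that(1)]]
      by (simp add: zs orthogonal_def)
    from norm_add_Pythagorean[OF this]
    have "(norm z)\<^sup>2 = (norm z_star)\<^sup>2 + (norm (z - z_star))\<^sup>2"
      by simp
    moreover have "0 < (norm (z - z_star))\<^sup>2"
      using that(2) by simp
    ultimately have "(norm z_star)\<^sup>2 < (norm z)\<^sup>2"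
      by linarith
    then show ?thesis
      by (rule power_less_imp_less_base) simp
  qed
  ultimately show ?thesis
    using ncp by blast
qed

end
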